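(* Let $I,J\subset\mathbb{R}$ be nonempty open intervals, let $f:I\to\mathbb{R}$ and $g:J\to\mathbb{R}$ be smooth, and let $M$ be the Type II translation surface in $\mathbb{R}^3$ parametrized by $\mathcal{F}(u,v)=(u,f(u)+g(v),v)$, $(u,v)\in I\times J$. Then $M$ is minimal with respect to the semi-symmetric metric connection $\nabla$ if and only if $\mathcal{F}$ is of one of the following forms on $I\times J$: (i) $\mathcal{F}(u,v)=\Big(u,\ \frac{c^2+1}{2c}\ln\Big|\cos\Big(\frac{2c}{\sqrt{c^2+1}}u-a\Big)\Big|+cv+b,\ v\Big)$ for some real constants $a,b,c$ with $c\neq0$ (with the cosine nonvanishing on $I$); (ii) $\mathcal{F}(u,v)=\Big(u,\ \int_{v_0}^v\frac{\varepsilon}{\sqrt{a e^{4x}-\frac{1}{c^2+1}}}\,dx+cu+b,\ v\Big)$ for some sign $\varepsilon\in\{1,-1\}$, some $v_0\in J$ and some real constants $a,b,c$ with $a>0$ (with $a e^{4x}-\frac1{c^2+1}>0$ for all $x\in J$); (iii) $\mathcal{F}(u,v)=(u,\ cu+b,\ v)$ for some real constants $b,c$.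
   Context: $\mathbb{R}^3$ carries the Euclidean metric $\widetilde g$, with coordinate fields $X_1=\partial_x$, $X_2=\partial_y$, $X_3=\partial_z$ and Levi-Civita connection $\nabla^L$ (so $\nabla^L_{X_i}X_j=0$). The semi-symmetric metric connection $\nabla$ is $$\nabla_XY=\nabla^L_XY+\widetilde g(Y,X_3)X-\widetilde g(X,Y)X_3 .$$ For an immersed surface $M$ parametrized by $\mathcal{F}(u,v)$, put $E_1=\mathcal{F}_u$, $E_2=\mathcal{F}_v$, let $N$ be a unit normal field, and let $E=\widetilde g(\mathcal{F}_u,\mathcal{F}_u)$, $F=\widetilde g(\mathcal{F}_u,\mathcal{F}_v)$, $G=\widetilde g(\mathcal{F}_v,\mathcal{F}_v)$. With $\sigma(X,Y)=\widetilde g(\nabla_XY,N)$ for $X,Y$ tangent to $M$ (not symmetric in general), the mean curvature with respect to $\nabla$ is $H=\frac12[\sigma(e_1,e_1)+\sigma(e_2,e_2)]$ for an orthonormal basis $e_1,e_2$ of $TM$, i.e. $$H=\frac{G\,\widetilde g(\nabla_{E_1}E_1,N)-F\,\widetilde g(\nabla_{E_1}E_2,N)-F\,\widetilde g(\nabla_{E_2}E_1,N)+E\,\widetilde g(\nabla_{E_2}E_2,N)}{2(EG-F^2)} .$$ $M$ is minimal with respect to $\nabla$ if $H=0$ everywhere. *)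

theory Defs
  imports "HOL-Analysis.Analysis"
begin

definition smooth_fun_on :: "(real \<Rightarrow> real) \<Rightarrow> real set \<Rightarrow> bool" where
  \<comment> \<open>Meant for open \<open>S\<close>, where \<open>(deriv ^^ k) f\<close> on \<open>S\<close> depends only on the values of \<open>f\<close> on \<open>S\<close>.\<close>
  "smooth_fun_on f S \<longleftrightarrow> (\<forall>k. \<forall>x\<in>S. (deriv ^^ k) f field_differentiable (at x))"

abbreviation X\<^sub>3 :: "real^3" where
  "X\<^sub>3 \<equiv> axis 3 1"

definition levi_civita :: "(real^3 \<Rightarrow> real^3) \<Rightarrow> (real^3 \<Rightarrow> real^3) \<Rightarrow> real^3 \<Rightarrow> real^3" where
  "levi_civita X Y q = frechet_derivative Y (at q) (X q)"

definition semi_symmetric :: "(real^3 \<Rightarrow> real^3) \<Rightarrow> (real^3 \<Rightarrow> real^3) \<Rightarrow> real^3 \<Rightarrow> real^3" where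
  "semi_symmetric X Y q = levi_civita X Y q + (Y q \<bullet> X\<^sub>3) *\<^sub>R X q - (X q \<bullet> Y q) *\<^sub>R X\<^sub>3"

definition partial_u :: "(real \<times> real \<Rightarrow> real^3) \<Rightarrow> real \<times> real \<Rightarrow> real^3" where
  "partial_u W p = vector_derivative (\<lambda>s. W (s, snd p)) (at (fst p))"

definition partial_v :: "(real \<times> real \<Rightarrow> real^3) \<Rightarrow> real \<times> real \<Rightarrow> real^3" where
  "partial_v W p = vector_derivative (\<lambda>t. W (fst p, t)) (at (snd p))"

text \<open>The fields \<open>E\<^sub>1\<close>, \<open>E\<^sub>2\<close> live on the parameter domain of a surface \<open>F\<close>, so the connection has to be
  pulled back along \<open>F\<close>: for a vector field \<open>W\<close> along \<open>F\<close>, the Levi-Civita derivative of \<open>W\<close> in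
  direction \<open>E\<^sub>1 = F\<^sub>u\<close> is \<open>W\<^sub>u\<close>, and similarly for \<open>E\<^sub>2 = F\<^sub>v\<close>. The argument \<open>D\<close> below is \<open>partial_u\<close> or
  \<open>partial_v\<close>, and \<open>D F\<close> is then \<open>E\<^sub>1\<close> or \<open>E\<^sub>2\<close>. The two lemmas after the definition show that this
  agrees with the connection of the ambient space for every extension \<open>Y\<close> of \<open>W\<close>.\<close>

definition semi_symmetric_along ::
  "((real \<times> real \<Rightarrow> real^3) \<Rightarrow> real \<times> real \<Rightarrow> real^3) \<Rightarrow> (real \<times> real \<Rightarrow> real^3) \<Rightarrow>
    (real \<times> real \<Rightarrow> real^3) \<Rightarrow> real \<times> real \<Rightarrow> real^3" where
  "semi_symmetric_along D F W p = D W p + (W p \<bullet> X\<^sub>3) *\<^sub>R D F p - (D F p \<bullet> W p) *\<^sub>R X\<^sub>3"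

lemma vector_derivative_extension:
  fixes Y :: "real^3 \<Rightarrow> real^3" and c :: "real \<Rightarrow> real^3"
  assumes "c differentiable (at s)" and "Y differentiable (at (c s))"
    and "\<forall>\<^sub>F x in nhds s. w x = Y (c x)"
  shows "vector_derivative w (at s) = frechet_derivative Y (at (c s)) (vector_derivative c (at s))"
proof (rule vector_derivative_at)
  have "(c has_vector_derivative vector_derivative c (at s)) (at s)"
    using assms(1) vector_derivative_works by blast
  moreover have "(Y has_derivative frechet_derivative Y (at (c s))) (at (c s))"
    using assms(2) frechet_derivative_works by blast
  ultimately have "((Y \<circ> c) has_vector_derivative
      frechet_derivative Y (at (c s)) (vector_derivative c (at s))) (at s)"
    by (intro vector_derivative_diff_chain_within)
       (auto intro: has_derivative_subset)
  moreover have "\<forall>\<^sub>F x in nhds s. x \<in> UNIV \<longrightarrow> (Y \<circ> c) x = w x"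
    using assms(3) by (auto elim: eventually_mono)
  moreover have "(Y \<circ> c) s = w s"
    using eventually_nhds_x_imp_x[OF assms(3)] by simp
  ultimately show "(w has_vector_derivative
      frechet_derivative Y (at (c s)) (vector_derivative c (at s))) (at s)"
    using has_vector_derivative_cong_ev[where S = UNIV and f = "Y \<circ> c" and g = w and x = s]
    by blast
qed

lemma semi_symmetric_along_u:
  assumes "(\<lambda>s. F (s, snd p)) differentiable (at (fst p))" and "Y differentiable (at (F p))"
    and "\<forall>\<^sub>F s in nhds (fst p). W (s, snd p) = Y (F (s, snd p))"
    and "X (F p) = partial_u F p"
  shows "semi_symmetric_along partial_u F W p = semi_symmetric X Y (F p)"
proof -
  have "W p = Y (F p)"
    using eventually_nhds_x_imp_x[OF assms(3)] by simp
  moreover have "partial_u W p = levi_civita X Y (F p)"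
    using vector_derivative_extension[OF assms(1) _ assms(3)] assms(2,4)
    by (simp add: partial_u_def levi_civita_def)
  ultimately show ?thesis
    using assms(4) by (simp add: semi_symmetric_along_def semi_symmetric_def)
qed

lemma semi_symmetric_along_v:
  assumes "(\<lambda>t. F (fst p, t)) differentiable (at (snd p))" and "Y differentiable (at (F p))"
    and "\<forall>\<^sub>F t in nhds (snd p). W (fst p, t) = Y (F (fst p, t))"
    and "X (F p) = partial_v F p"
  shows "semi_symmetric_along partial_v F W p = semi_symmetric X Y (F p)"
proof -
  have "W p = Y (F p)"
    using eventually_nhds_x_imp_x[OF assms(3)] by simp
  moreover have "partial_v W p = levi_civita X Y (F p)"
    using vector_derivative_extension[OF assms(1) _ assms(3)] assms(2,4)
    by (simp add: partial_v_def levi_civita_def)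
  ultimately show ?thesis
    using assms(4) by (simp add: semi_symmetric_along_def semi_symmetric_def)
qed

definition unit_normal_field ::
  "(real \<times> real \<Rightarrow> real^3) \<Rightarrow> (real \<times> real) set \<Rightarrow> (real \<times> real \<Rightarrow> real^3) \<Rightarrow> bool" where
  "unit_normal_field F S N \<longleftrightarrow> continuous_on S N \<and>
    (\<forall>p\<in>S. norm (N p) = 1 \<and> N p \<bullet> partial_u F p = 0 \<and> N p \<bullet> partial_v F p = 0)"

lemma unit_normal_field_cross3:
  assumes "continuous_on S (partial_u F)" and "continuous_on S (partial_v F)"
    and "\<And>p. p \<in> S \<Longrightarrow> cross3 (partial_u F p) (partial_v F p) \<noteq> 0"
  shows "unit_normal_field F S (\<lambda>p. sgn (cross3 (partial_u F p) (partial_v F p)))"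
  unfolding unit_normal_field_def
  using assms
  by (auto intro!: continuous_on_sgn continuous_on_cross simp: norm_sgn)
     (auto simp: sgn_div_norm dot_cross_self)

definition mean_curvature ::
  "(real \<times> real \<Rightarrow> real^3) \<Rightarrow> (real \<times> real \<Rightarrow> real^3) \<Rightarrow> real \<times> real \<Rightarrow> real" where
  "mean_curvature F N p =
    (let E\<^sub>1 = partial_u F; E\<^sub>2 = partial_v F;
         E = E\<^sub>1 p \<bullet> E\<^sub>1 p; Fm = E\<^sub>1 p \<bullet> E\<^sub>2 p; G = E\<^sub>2 p \<bullet> E\<^sub>2 p
     in (G * (semi_symmetric_along partial_u F E\<^sub>1 p \<bullet> N p)
         - Fm * (semi_symmetric_along partial_u F E\<^sub>2 p \<bullet> N p)
         - Fm * (semi_symmetric_along partial_v F E\<^sub>1 p \<bullet> N p)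
         + E * (semi_symmetric_along partial_v F E\<^sub>2 p \<bullet> N p))
        / (2 * (E * G - Fm\<^sup>2)))"

definition minimal_surface ::
  "(real \<times> real \<Rightarrow> real^3) \<Rightarrow> (real \<times> real) set \<Rightarrow> (real \<times> real \<Rightarrow> real^3) \<Rightarrow> bool" where
  \<comment> \<open>Replacing the unit normal field \<open>N\<close> by \<open>- N\<close> only changes the sign of the mean curvature.\<close>
  "minimal_surface F S N \<longleftrightarrow> (\<forall>p\<in>S. mean_curvature F N p = 0)"

definition translation_surface_II :: "(real \<Rightarrow> real) \<Rightarrow> (real \<Rightarrow> real) \<Rightarrow> real \<times> real \<Rightarrow> real^3" where
  "translation_surface_II f g = (\<lambda>(u, v). vector [u, f u + g v, v])"

end

theory Submission
  imports Defs
begin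

text \<open>Write \<open>p = f'\<close> and \<open>q = g'\<close>. The vector \<open>(p, - 1, q)\<close> is normal to the surface, and
  \<open>E G - F\<^sup>2 = 1 + p\<^sup>2 + q\<^sup>2\<close>. Up to a common sign, the Levi-Civita derivatives
  contribute \<open>(1 + q\<^sup>2) p' + (1 + p\<^sup>2) q'\<close> to the numerator of the mean curvature, as for any graph of a
  sum, and the remaining terms of the connection contribute \<open>2 (E G - F\<^sup>2)\<close> times the component \<open>q\<close> of
  this normal along \<open>X\<^sub>3\<close>. So minimality is the equation
  \<open>(1 + q\<^sup>2) p' + (1 + p\<^sup>2) q' + 2 q (1 + p\<^sup>2 + q\<^sup>2) = 0\<close> in the two independent variables \<open>u\<close> and \<open>v\<close>
  (\<open>minimal_translation_surface_II_iff\<close>).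

  Divided by \<open>1 + q\<^sup>2\<close>, it says \<open>p' + \<alpha> (1 + p\<^sup>2) + 2 \<beta> = 0\<close>, where
  \<open>\<alpha> = (q' + 2 q) / (1 + q\<^sup>2)\<close> and \<open>\<beta> = q\<^sup>3 / (1 + q\<^sup>2)\<close> depend on \<open>v\<close> only. If \<open>p\<close>
  is not constant, then \<open>p\<^sup>2\<close> takes two values, which determine \<open>\<alpha>\<close> and \<open>\<beta>\<close> independently of
  \<open>v\<close>; as \<open>q\<close> is determined by \<open>\<beta>\<close>, it is constant (\<open>separation\<close>). Hence one of \<open>p\<close> and \<open>q\<close> is constant, and an ordinary differential equation remains for the other.

  If \<open>q = c\<close>, it is the Riccati equation \<open>(c\<^sup>2 + 1) p' = - 2 c (c\<^sup>2 + 1 + p\<^sup>2)\<close>. Here \<open>c \<noteq> 0\<close>, as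
  otherwise \<open>p\<close> would be constant, and \<open>p\<close> is a tangent, which integrates to the logarithm of a cosine
  (\<open>riccati_solution\<close>). If \<open>p = c\<close>, it is the Bernoulli equation
  \<open>(c\<^sup>2 + 1) q' + 2 q (c\<^sup>2 + 1 + q\<^sup>2) = 0\<close>, in which \<open>1 / q\<^sup>2\<close> satisfies a linear equation. Either \<open>q\<close>
  vanishes identically, which gives the planes, or it has no zero, which gives the integrals
  (\<open>bernoulli_solution\<close>). Conversely, the three families solve the equation.\<close>

section \<open>Mean curvature of a translation surface\<close>

lemma vector_3_axis:
  "(vector [a, b, c] :: real^3) = a *\<^sub>R axis 1 1 + b *\<^sub>R axis 2 1 + c *\<^sub>R axis 3 1"
  by (simp add: vec_eq_iff forall_3 axis_def)

lemma inner_vector_3: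
  fixes x :: "real^3"
  shows "(vector [a, b, c] :: real^3) \<bullet> x = a * x $ 1 + b * x $ 2 + c * x $ 3"
  by (simp add: inner_vec_def sum_3)

lemma has_vector_derivative_vector_3:
  assumes "(a has_real_derivative a') (at s)" "(b has_real_derivative b') (at s)"
    "(c has_real_derivative c') (at s)"
  shows "((\<lambda>s. vector [a s, b s, c s] :: real^3) has_vector_derivative vector [a', b', c']) (at s)"
  unfolding vector_3_axis
  by (rule derivative_eq_intros refl assms)+ simp

lemma partials_translation_surface_II:
  assumes "(f has_real_derivative p) (at u)" "(g has_real_derivative q) (at v)"
  shows "partial_u (translation_surface_II f g) (u, v) = vector [1, p, 0]"
    and "partial_v (translation_surface_II f g) (u, v) = vector [0, q, 1]"
proof -
  show "partial_u (translation_surface_II f g) (u, v) = vector [1, p, 0]"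
    unfolding partial_u_def translation_surface_II_def
    by (auto intro!: vector_derivative_at has_vector_derivative_vector_3 derivative_eq_intros assms)
  show "partial_v (translation_surface_II f g) (u, v) = vector [0, q, 1]"
    unfolding partial_v_def translation_surface_II_def
    by (auto intro!: vector_derivative_at has_vector_derivative_vector_3 derivative_eq_intros assms)
qed

text \<open>The values of the first partial derivatives are known on \<open>I \<times> J\<close> only, which determines the second
  ones because \<open>I\<close> and \<open>J\<close> are open.\<close>

lemma second_partials_translation_surface_II:
  assumes "open I" "open J" "u \<in> I" "v \<in> J"
    and f: "\<And>s. s \<in> I \<Longrightarrow> (f has_real_derivative p s) (at s)"
    and g: "\<And>t. t \<in> J \<Longrightarrow> (g has_real_derivative q t) (at t)"
    and p: "(p has_real_derivative p') (at u)" and q: "(q has_real_derivative q') (at v)"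
  defines "F \<equiv> translation_surface_II f g"
  shows "partial_u (partial_u F) (u, v) = vector [0, p', 0]"
    and "partial_u (partial_v F) (u, v) = 0"
    and "partial_v (partial_u F) (u, v) = 0"
    and "partial_v (partial_v F) (u, v) = vector [0, q', 0]"
proof -
  have E1: "partial_u F (s, t) = vector [1, p s, 0]"
    and E2: "partial_v F (s, t) = vector [0, q t, 1]" if "s \<in> I" "t \<in> J" for s t
    using partials_translation_surface_II[OF f g] that unfolding F_def by auto
  have along_u: "partial_u W (u, v) = d"
    if "((\<lambda>s. w s) has_vector_derivative d) (at u)" "\<And>s. s \<in> I \<Longrightarrow> W (s, v) = w s" for W w d
    unfolding partial_u_def
    using has_vector_derivative_transform_within_open[OF _ assms(1,3), of w d "\<lambda>s. W (s, v)"] that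
    by (auto intro!: vector_derivative_at)
  have along_v: "partial_v W (u, v) = d"
    if "((\<lambda>t. w t) has_vector_derivative d) (at v)" "\<And>t. t \<in> J \<Longrightarrow> W (u, t) = w t" for W w d
    unfolding partial_v_def
    using has_vector_derivative_transform_within_open[OF _ assms(2,4), of w d "\<lambda>t. W (u, t)"] that
    by (auto intro!: vector_derivative_at)
  show "partial_u (partial_u F) (u, v) = vector [0, p', 0]"
    by (rule along_u[OF has_vector_derivative_vector_3[where a = "\<lambda>_. 1" and c = "\<lambda>_. 0",
          OF DERIV_const p DERIV_const]])
       (simp add: E1 assms(3,4))
  show "partial_u (partial_v F) (u, v) = 0"
    by (rule along_u[OF has_vector_derivative_const]) (simp add: E2 assms(3,4))
  show "partial_v (partial_u F) (u, v) = 0"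
    by (rule along_v[OF has_vector_derivative_const]) (simp add: E1 assms(3,4))
  show "partial_v (partial_v F) (u, v) = vector [0, q', 0]"
    by (rule along_v[OF has_vector_derivative_vector_3[where a = "\<lambda>_. 0" and c = "\<lambda>_. 1",
          OF DERIV_const q DERIV_const]])
       (simp add: E2 assms(3,4))
qed

text \<open>The first and second derivatives are parameters rather than \<open>deriv f\<close> and so on, so that the lemma
  also applies when they are given by explicit formulas. A normal vector is a multiple of
  \<open>(p, - 1, q)\<close>, and both this multiple and \<open>E G - F\<^sup>2\<close> are nonzero, so they do not affect whether the mean
  curvature vanishes.\<close>

lemma minimal_translation_surface_II_iff:
  assumes "open I" "open J"
    and f: "\<And>u. u \<in> I \<Longrightarrow> (f has_real_derivative p u) (at u)"
    and p: "\<And>u. u \<in> I \<Longrightarrow> (p has_real_derivative p' u) (at u)"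
    and g: "\<And>v. v \<in> J \<Longrightarrow> (g has_real_derivative q v) (at v)"
    and q: "\<And>v. v \<in> J \<Longrightarrow> (q has_real_derivative q' v) (at v)"
    and N: "unit_normal_field (translation_surface_II f g) (I \<times> J) N"
  shows "minimal_surface (translation_surface_II f g) (I \<times> J) N \<longleftrightarrow>
    (\<forall>u\<in>I. \<forall>v\<in>J. (1 + (q v)\<^sup>2) * p' u + (1 + (p u)\<^sup>2) * q' v
        + 2 * q v * (1 + (p u)\<^sup>2 + (q v)\<^sup>2) = 0)"
proof -
  let ?F = "translation_surface_II f g"
  have "mean_curvature ?F N (u, v) = 0 \<longleftrightarrow>
      (1 + (q v)\<^sup>2) * p' u + (1 + (p u)\<^sup>2) * q' v + 2 * q v * (1 + (p u)\<^sup>2 + (q v)\<^sup>2) = 0"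
    if u: "u \<in> I" and v: "v \<in> J" for u v
  proof -
    define n1 n2 n3 where n: "n1 = N (u, v) $ 1" "n2 = N (u, v) $ 2" "n3 = N (u, v) $ 3"
    note E = partials_translation_surface_II[OF f[OF u] g[OF v]]
    have EE: "partial_u (partial_u ?F) (u, v) = vector [0, p' u, 0]"
      "partial_u (partial_v ?F) (u, v) = 0" "partial_v (partial_u ?F) (u, v) = 0"
      "partial_v (partial_v ?F) (u, v) = vector [0, q' v, 0]"
      by (rule second_partials_translation_surface_II[OF assms(1,2) u v f g p[OF u] q[OF v]];
          assumption)+
    have N1: "norm (N (u, v)) = 1" and "partial_u ?F (u, v) \<bullet> N (u, v) = 0"
      "partial_v ?F (u, v) \<bullet> N (u, v) = 0"
      using N u v by (auto simp: unit_normal_field_def inner_commute)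
    then have n1: "n1 = - p u * n2" and n3: "n3 = - q v * n2"
      unfolding E inner_vector_3 n[symmetric] by simp_all
    have n2: "n2 \<noteq> 0"
    proof
      assume "n2 = 0"
      then have "N (u, v) = 0"
        using n1 n3 unfolding n by (simp add: vec_eq_iff forall_3)
      with N1 show False
        by simp
    qed
    have pos: "(1 + (p u)\<^sup>2) * (1 + (q v)\<^sup>2) - (p u * q v)\<^sup>2 > 0"
      by (simp add: algebra_simps power_mult_distrib add_pos_nonneg)
    have "mean_curvature ?F N (u, v) =
        n2 * ((1 + (q v)\<^sup>2) * p' u + (1 + (p u)\<^sup>2) * q' v + 2 * q v * (1 + (p u)\<^sup>2 + (q v)\<^sup>2))
        / (2 * ((1 + (p u)\<^sup>2) * (1 + (q v)\<^sup>2) - (p u * q v)\<^sup>2))"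
      unfolding mean_curvature_def semi_symmetric_along_def Let_def E EE
      by (simp add: inner_vector_3 inner_add_left inner_diff_left inner_axis inner_axis'
          n[symmetric] n1 n3 power2_eq_square)
        (rule arg_cong2[where f = "(/)"], simp_all add: algebra_simps)
    then show ?thesis
      using pos n2 by simp
  qed
  then show ?thesis
    by (auto simp: minimal_surface_def)
qed

section \<open>Separation of variables\<close>

lemma is_interval_IVT_zero:
  fixes p :: "real \<Rightarrow> real"
  assumes "is_interval I" "continuous_on I p" "x \<in> I" "y \<in> I" "p x \<le> 0" "0 \<le> p y"
  obtains z where "z \<in> I" "p z = 0"
proof -
  have "is_interval (p ` I)"
    using assms(1,2) connected_continuous_image is_interval_connected_1 by blast
  then have "0 \<in> p ` I"
    using assms(3-6) mem_is_interval_1_I[of "p ` I" "p x" "p y" 0] by blast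
  then show ?thesis
    using that by force
qed

text \<open>If \<open>p\<^sup>2\<close> agrees at two points where \<open>p\<close> differs, then \<open>p\<close> changes sign between them, and a zero of
  \<open>p\<close> provides a second value of \<open>p\<^sup>2\<close>.\<close>

lemma obtain_distinct_squares:
  fixes p :: "real \<Rightarrow> real"
  assumes "is_interval I" "continuous_on I p" "x \<in> I" "y \<in> I" "p x \<noteq> p y"
  obtains r s where "r \<in> I" "s \<in> I" "(p r)\<^sup>2 \<noteq> (p s)\<^sup>2"
proof (cases "(p x)\<^sup>2 = (p y)\<^sup>2")
  case True
  then have neg: "p y = - p x" "p x \<noteq> 0"
    using assms(5) by (auto simp: power2_eq_iff)
  then have "p x \<le> 0 \<and> 0 \<le> p y \<or> p y \<le> 0 \<and> 0 \<le> p x"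
    by auto
  then obtain z where "z \<in> I" "p z = 0"
    using assms(3,4) by (elim disjE conjE is_interval_IVT_zero[OF assms(1,2), rotated 2]) blast+
  then show ?thesis
    using that[of x z] assms(3) neg by simp
qed (use that assms in blast)

text \<open>After clearing denominators, the difference of the two sides is \<open>x - y\<close> times a sum of squares that
  vanishes only at \<open>x = y = 0\<close>.\<close>

lemma cube_ratio_inj:
  fixes x y :: real
  assumes "x^3 / (1 + x\<^sup>2) = y^3 / (1 + y\<^sup>2)"
  shows "x = y"
proof (rule ccontr)
  assume "x \<noteq> y"
  have "1 + x\<^sup>2 > 0" "1 + y\<^sup>2 > 0"
    by (simp_all add: add_pos_nonneg)
  with assms have "x^3 * (1 + y\<^sup>2) = y^3 * (1 + x\<^sup>2)"
    by (simp add: field_simps)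
  then have "(x - y) * (x\<^sup>2 + x * y + y\<^sup>2 + x\<^sup>2 * y\<^sup>2) = 0"
    by (simp add: algebra_simps power2_eq_square power3_eq_cube)
  then have "x\<^sup>2 + x * y + y\<^sup>2 + x\<^sup>2 * y\<^sup>2 = 0"
    using \<open>x \<noteq> y\<close> by simp
  moreover have "x\<^sup>2 + x * y + y\<^sup>2 = (x + y / 2)\<^sup>2 + 3 / 4 * y\<^sup>2"
    by (simp add: power2_eq_square algebra_simps)
  moreover have "(x + y / 2)\<^sup>2 \<ge> 0" "y\<^sup>2 \<ge> 0" "x\<^sup>2 * y\<^sup>2 \<ge> 0"
    by simp_all
  ultimately have "y\<^sup>2 = 0" "(x + y / 2)\<^sup>2 = 0"
    by linarith+
  then show False
    using \<open>x \<noteq> y\<close> by simp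
qed

text \<open>For fixed \<open>v\<close>, the equation divided by \<open>1 + (q v)\<^sup>2\<close>, taken at \<open>r\<close> and \<open>s\<close>, gives two linear
  equations for the unknowns \<open>\<alpha> v\<close> and \<open>\<beta> v\<close>. They are independent because \<open>(p r)\<^sup>2 \<noteq> (p s)\<^sup>2\<close>, and nothing
  else in them depends on \<open>v\<close>.\<close>

lemma separation:
  fixes p p' q q' :: "real \<Rightarrow> real"
  assumes ode: "\<And>u v. u \<in> I \<Longrightarrow> v \<in> J \<Longrightarrow>
      (1 + (q v)\<^sup>2) * p' u + (1 + (p u)\<^sup>2) * q' v + 2 * q v * (1 + (p u)\<^sup>2 + (q v)\<^sup>2) = 0"
    and rs: "r \<in> I" "s \<in> I" "(p r)\<^sup>2 \<noteq> (p s)\<^sup>2" and vw: "v \<in> J" "w \<in> J"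
  shows "q v = q w"
proof -
  define \<alpha> \<beta> where "\<alpha> t = (q' t + 2 * q t) / (1 + (q t)\<^sup>2)"
    and "\<beta> t = (q t)^3 / (1 + (q t)\<^sup>2)" for t
  have split: "p' u + \<alpha> t * (1 + (p u)\<^sup>2) + 2 * \<beta> t = 0" if "u \<in> I" "t \<in> J" for u t
  proof -
    define D where "D = 1 + (q t)\<^sup>2"
    have "D > 0"
      unfolding D_def by (simp add: add_pos_nonneg)
    have "p' u + \<alpha> t * (1 + (p u)\<^sup>2) + 2 * \<beta> t
        = (D * p' u + (q' t + 2 * q t) * (1 + (p u)\<^sup>2) + 2 * (q t)^3) / D"
      unfolding \<alpha>_def \<beta>_def D_def[symmetric] using \<open>D > 0\<close> by (simp add: field_simps)
    also have "D * p' u + (q' t + 2 * q t) * (1 + (p u)\<^sup>2) + 2 * (q t)^3 = 0"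
      using ode[OF that] unfolding D_def
      by (simp add: algebra_simps power2_eq_square power3_eq_cube)
    finally show ?thesis
      by simp
  qed
  have "(\<alpha> v - \<alpha> w) * ((p r)\<^sup>2 - (p s)\<^sup>2) = 0"
    using split[OF rs(1) vw(1)] split[OF rs(1) vw(2)] split[OF rs(2) vw(1)] split[OF rs(2) vw(2)]
    by (simp add: algebra_simps)
  then have "\<alpha> v = \<alpha> w"
    using rs(3) by simp
  then have "\<beta> v = \<beta> w"
    using split[OF rs(1) vw(1)] split[OF rs(1) vw(2)] by simp
  then show ?thesis
    unfolding \<beta>_def by (rule cube_ratio_inj)
qed

section \<open>Functions with a prescribed derivative\<close>

lemma is_interval_DERIV_zero_constant:
  fixes f :: "real \<Rightarrow> real"
  assumes "is_interval S" "\<And>x. x \<in> S \<Longrightarrow> (f has_real_derivative 0) (at x)"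
  obtains c where "\<And>x. x \<in> S \<Longrightarrow> f x = c"
proof -
  have "\<exists>c. \<forall>x\<in>S. f x = c"
    using assms has_field_derivative_zero_constant[of S f]
    by (auto intro: has_field_derivative_at_within simp: is_interval_convex)
  then show ?thesis
    using that by blast
qed

lemma is_interval_DERIV_eq_obtain_const:
  fixes f h :: "real \<Rightarrow> real"
  assumes "is_interval S" "\<And>x. x \<in> S \<Longrightarrow> (f has_real_derivative d x) (at x)"
    "\<And>x. x \<in> S \<Longrightarrow> (h has_real_derivative d x) (at x)"
  obtains b where "\<And>x. x \<in> S \<Longrightarrow> f x = h x + b"
proof -
  have "((\<lambda>x. f x - h x) has_real_derivative 0) (at x)" if "x \<in> S" for x
    using DERIV_diff[OF assms(2,3)[OF that]] by simp
  then obtain b where "\<And>x. x \<in> S \<Longrightarrow> f x - h x = b"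
    using is_interval_DERIV_zero_constant[OF assms(1), of "\<lambda>x. f x - h x"] by blast
  then show ?thesis
    using that[of b] by (simp add: algebra_simps)
qed

text \<open>The base point may lie on either side of \<open>v\<close>, and the fundamental theorem gives a derivative within any
  closed interval in \<open>J\<close> that contains both. One with \<open>v\<close> in its interior exists because \<open>J\<close> is open.\<close>

lemma interval_integral_has_derivative:
  fixes h :: "real \<Rightarrow> real"
  assumes "open J" "is_interval J" "v\<^sub>0 \<in> J" "v \<in> J" "continuous_on J h"
  shows "((\<lambda>v. LBINT x=ereal v\<^sub>0..ereal v. h x) has_real_derivative h v) (at v)"
proof -
  obtain e where e: "e > 0" "cball v e \<subseteq> J"
    using assms(1,4) open_contains_cball by blast
  define lo hi where "lo = min v\<^sub>0 (v - e)" and "hi = max v\<^sub>0 (v + e)"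
  have "v - e \<in> J" "v + e \<in> J"
    using e by (auto simp: cball_def dist_real_def subset_iff)
  then have lohi: "lo \<in> J" "hi \<in> J"
    using assms(3) by (auto simp: lo_def hi_def min_def max_def)
  have sub: "{lo..hi} \<subseteq> J"
    by (auto intro: mem_is_interval_1_I[OF assms(2) lohi])
  have "((\<lambda>v. LBINT x=ereal v\<^sub>0..ereal v. h x) has_vector_derivative h v) (at v within {lo..hi})"
    using e(1) by (intro interval_integral_FTC2 continuous_on_subset[OF assms(5) sub])
      (auto simp: lo_def hi_def)
  moreover have "v \<in> interior {lo..hi}"
    using e(1) by (auto simp: lo_def hi_def)
  ultimately show ?thesis
    unfolding has_real_derivative_iff_has_vector_derivative by (simp only: at_within_interior)
qed

text \<open>The parametrization determines \<open>f\<close> and \<open>g\<close> only up to a constant that can be moved from one to the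
  other, so the derivatives have to be read off from \<open>f u + g v\<close> with one of the variables held fixed.\<close>

lemma split_sum_has_derivative:
  fixes f g \<phi> :: "real \<Rightarrow> real"
  assumes "open I" "u \<in> I" "v \<in> J" "\<And>s. s \<in> I \<Longrightarrow> f s + g v = \<phi> s + k"
    and "(\<phi> has_real_derivative d) (at u)"
  shows "(f has_real_derivative d) (at u)"
proof (rule has_field_derivative_transform_within_open[OF _ assms(1,2)])
  show "((\<lambda>s. \<phi> s + (k - g v)) has_real_derivative d) (at u)"
    using assms(5) by (auto intro!: derivative_eq_intros)
  show "\<phi> s + (k - g v) = f s" if "s \<in> I" for s
    using assms(4)[OF that] by simp
qed

lemma DERIV_zero_of_constant_on:
  fixes q :: "real \<Rightarrow> real"
  assumes "open J" "v \<in> J" "(q has_real_derivative d) (at v)" "\<And>t. t \<in> J \<Longrightarrow> q t = c"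
  shows "d = 0"
proof -
  have "((\<lambda>_. c) has_real_derivative d) (at v)"
    using assms by (intro has_field_derivative_transform_within_open[OF assms(3,1,2)]) auto
  then show ?thesis
    using DERIV_unique DERIV_const by blast
qed

section \<open>The Riccati equation\<close>

text \<open>The equation says that \<open>arctan (p u / s)\<close> has the constant derivative \<open>- 2 * c / s\<close>. The cosine does not
  vanish because its argument is the negative of a value of \<open>arctan\<close>.\<close>

lemma riccati_solution:
  fixes p p' :: "real \<Rightarrow> real"
  assumes "is_interval I"
    and p: "\<And>u. u \<in> I \<Longrightarrow> (p has_real_derivative p' u) (at u)"
    and ode: "\<And>u. u \<in> I \<Longrightarrow> (c\<^sup>2 + 1) * p' u = - 2 * c * (c\<^sup>2 + 1 + (p u)\<^sup>2)"
  defines "s \<equiv> sqrt (c\<^sup>2 + 1)"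
  obtains a where "\<And>u. u \<in> I \<Longrightarrow> cos (2 * c / s * u - a) \<noteq> 0"
    "\<And>u. u \<in> I \<Longrightarrow> p u = - s * tan (2 * c / s * u - a)"
proof -
  have s: "s > 0" "s\<^sup>2 = c\<^sup>2 + 1"
    unfolding s_def by (simp_all add: add_nonneg_pos)
  have "((\<lambda>u. arctan (p u / s) + 2 * c / s * u) has_real_derivative 0) (at u)" if "u \<in> I" for u
  proof -
    have pos: "s\<^sup>2 + (p u)\<^sup>2 > 0"
      using s(1) by (intro add_pos_nonneg) simp_all
    have p': "p' u = - 2 * c * (s\<^sup>2 + (p u)\<^sup>2) / s\<^sup>2"
      using ode[OF that, folded s(2)] s(1) by (simp add: field_simps)
    have "inverse (1 + (p u / s)\<^sup>2) = s\<^sup>2 / (s\<^sup>2 + (p u)\<^sup>2)"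
      using s(1) pos by (simp add: field_simps power_divide)
    then have "inverse (1 + (p u / s)\<^sup>2) * (p' u / s) + 2 * c / s = 0"
      unfolding p' using s(1) pos by (simp add: power2_eq_square)
    then show ?thesis
      using s(1) by (auto intro!: derivative_eq_intros p that)
  qed
  then obtain a where a: "\<And>u. u \<in> I \<Longrightarrow> arctan (p u / s) + 2 * c / s * u = a"
    using is_interval_DERIV_zero_constant[OF assms(1), of "\<lambda>u. arctan (p u / s) + 2 * c / s * u"]
    by blast
  have phase: "2 * c / s * u - a = - arctan (p u / s)" if "u \<in> I" for u
    using a[OF that] by simp
  show ?thesis
    by (rule that[of a]) (use s in \<open>simp_all only: phase cos_minus tan_minus\<close>, simp_all add: tan_arctan)
qed

lemma ln_abs_has_derivative:
  fixes x :: real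
  assumes "x \<noteq> 0"
  shows "((\<lambda>x. ln \<bar>x\<bar>) has_real_derivative 1 / x) (at x)"
proof (cases "x > 0")
  case True
  then have "(ln has_real_derivative 1 / x) (at x)"
    by (rule DERIV_ln_divide)
  then show ?thesis
    by (rule has_field_derivative_transform_within_open[where S = "{0<..}"]) (use True in auto)
next
  case False
  then have "((\<lambda>x. ln (- x)) has_real_derivative 1 / x) (at x)"
    using assms by (auto intro!: derivative_eq_intros)
  then show ?thesis
    by (rule has_field_derivative_transform_within_open[where S = "{..<0}"]) (use assms False in auto)
qed

lemma log_cos_has_derivative:
  assumes "c \<noteq> 0" and "cos (2 * c / sqrt (c\<^sup>2 + 1) * u - a) \<noteq> 0"
  shows "((\<lambda>u. (c\<^sup>2 + 1) / (2 * c) * ln \<bar>cos (2 * c / sqrt (c\<^sup>2 + 1) * u - a)\<bar>)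
    has_real_derivative - sqrt (c\<^sup>2 + 1) * tan (2 * c / sqrt (c\<^sup>2 + 1) * u - a)) (at u)"
proof -
  define s where "s = sqrt (c\<^sup>2 + 1)"
  have s: "s > 0" "c\<^sup>2 + 1 = s * s"
    unfolding s_def by (simp_all add: add_nonneg_pos)
  define k where "k = 2 * c / s"
  have nz: "cos (k * u - a) \<noteq> 0"
    using assms(2) unfolding k_def s_def by simp
  have "((\<lambda>u. cos (k * u - a)) has_real_derivative - sin (k * u - a) * k) (at u)"
    by (auto intro!: derivative_eq_intros)
  from DERIV_cmult[OF DERIV_chain2[OF ln_abs_has_derivative[OF nz] this], of "(c\<^sup>2 + 1) / (2 * c)"]
  have "((\<lambda>u. (c\<^sup>2 + 1) / (2 * c) * ln \<bar>cos (k * u - a)\<bar>) has_real_derivative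
      (c\<^sup>2 + 1) / (2 * c) * (1 / cos (k * u - a) * (- sin (k * u - a) * k))) (at u)" .
  moreover have "(c\<^sup>2 + 1) / (2 * c) * (1 / cos (k * u - a) * (- sin (k * u - a) * k))
      = - ((c\<^sup>2 + 1) / (2 * c) * k) * tan (k * u - a)"
    by (simp add: tan_def)
  moreover have "(c\<^sup>2 + 1) / (2 * c) * k = s"
    unfolding k_def s(2) using s(1) assms(1) by simp
  ultimately show ?thesis
    unfolding k_def s_def by (simp only:)
qed

lemma tan_has_derivative_affine:
  fixes s k a u :: real
  assumes "cos (k * u - a) \<noteq> 0"
  shows "((\<lambda>u. - s * tan (k * u - a)) has_real_derivative - s * k * (1 + (tan (k * u - a))\<^sup>2)) (at u)"
proof -
  have "1 + (tan (k * u - a))\<^sup>2 = inverse ((cos (k * u - a))\<^sup>2)"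
    using tan_sec[OF assms] by (simp add: power_inverse)
  then show ?thesis
    using assms by (auto intro!: derivative_eq_intros)
qed

section \<open>The Bernoulli equation\<close>

text \<open>The function \<open>1 / q\<^sup>2\<close> satisfies a linear equation with the solutions \<open>a * exp (4 * v) - 1 / m\<close>, so
  \<open>exp (- 4 * v) * (1 / q\<^sup>2 + 1 / m)\<close> is constant. The proof uses a multiple of its reciprocal,
  \<open>exp (4 * v) * q\<^sup>2 / (m + q\<^sup>2)\<close>, which also makes sense where \<open>q\<close> vanishes: it shows at the same time that a
  solution with a nonzero value has no zero at all, and hence a constant sign \<open>\<epsilon>\<close>.\<close>

lemma bernoulli_solution:
  fixes q q' :: "real \<Rightarrow> real"
  assumes "is_interval J" "v\<^sub>0 \<in> J" and "m > 0"
    and q: "\<And>v. v \<in> J \<Longrightarrow> (q has_real_derivative q' v) (at v)"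
    and ode: "\<And>v. v \<in> J \<Longrightarrow> m * q' v + 2 * q v * (m + (q v)\<^sup>2) = 0"
    and nz: "q v\<^sub>0 \<noteq> 0"
  obtains \<epsilon> a :: real where "\<epsilon> \<in> {1, - 1}" "a > 0"
    "\<And>v. v \<in> J \<Longrightarrow> a * exp (4 * v) - 1 / m > 0"
    "\<And>v. v \<in> J \<Longrightarrow> q v = \<epsilon> / sqrt (a * exp (4 * v) - 1 / m)"
proof -
  have pos: "m + (q v)\<^sup>2 > 0" for v
    using \<open>m > 0\<close> by (simp add: add_pos_nonneg)
  \<comment> \<open>Here \<open>q\<^sup>2 / (m + q\<^sup>2)\<close> is written as \<open>1 - m / (m + q\<^sup>2)\<close>, which is easier to differentiate.\<close>
  have "((\<lambda>v. exp (4 * v) * (1 - m / (m + (q v)\<^sup>2))) has_real_derivative 0) (at v)"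
    if "v \<in> J" for v
  proof -
    have q'v: "q' v = - 2 * q v * (m + (q v)\<^sup>2) / m"
      using ode[OF that] \<open>m > 0\<close> by (simp add: field_simps)
    have ne: "m + (q v)\<^sup>2 \<noteq> 0"
      using pos[of v] by simp
    have "1 - m / (m + (q v)\<^sup>2) = (q v)\<^sup>2 / (m + (q v)\<^sup>2)"
      using ne by (simp add: field_simps)
    moreover have "m * (2 * q v * q' v) / (m + (q v)\<^sup>2)\<^sup>2 = - 4 * ((q v)\<^sup>2 / (m + (q v)\<^sup>2))"
      unfolding q'v using ne \<open>m > 0\<close> by (simp add: divide_simps) (simp add: algebra_simps power2_eq_square)
    ultimately have "4 * exp (4 * v) * (1 - m / (m + (q v)\<^sup>2))
        + exp (4 * v) * (m * (2 * q v * q' v) / (m + (q v)\<^sup>2)\<^sup>2) = 0"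
      by simp
    moreover have "((\<lambda>v. exp (4 * v) * (1 - m / (m + (q v)\<^sup>2))) has_real_derivative
        4 * exp (4 * v) * (1 - m / (m + (q v)\<^sup>2))
        + exp (4 * v) * (m * (2 * q v * q' v) / (m + (q v)\<^sup>2)\<^sup>2)) (at v)"
      using ne by (auto intro!: derivative_eq_intros q that simp: power2_eq_square)
    ultimately show ?thesis
      by simp
  qed
  then obtain K where K: "\<And>v. v \<in> J \<Longrightarrow> exp (4 * v) * (1 - m / (m + (q v)\<^sup>2)) = K"
    using is_interval_DERIV_zero_constant[OF assms(1),
        of "\<lambda>v. exp (4 * v) * (1 - m / (m + (q v)\<^sup>2))"]
    by blast
  have K': "exp (4 * v) * (q v)\<^sup>2 = K * (m + (q v)\<^sup>2)" if "v \<in> J" for v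
    using K[OF that, symmetric] pos[of v] by (simp add: field_simps)
  have "K * (m + (q v\<^sub>0)\<^sup>2) > 0"
    using K'[OF assms(2)] nz by (metis exp_gt_zero mult_pos_pos zero_less_power2)
  then have "K > 0"
    using pos[of v\<^sub>0] by (simp add: zero_less_mult_iff)
  have qnz: "q v \<noteq> 0" if "v \<in> J" for v
    using K'[OF that] \<open>K > 0\<close> \<open>m > 0\<close> by auto
  \<comment> \<open>Solving \<open>K'\<close> for \<open>1 / q\<^sup>2\<close> shows that \<open>a = 1 / (K * m)\<close>.\<close>
  have recip: "1 / (K * m) * exp (4 * v) - 1 / m = 1 / (q v)\<^sup>2" if "v \<in> J" for v
    using K'[OF that] qnz[OF that] \<open>K > 0\<close> \<open>m > 0\<close> by (simp add: field_simps)
  have sgn: "sgn (q v) = sgn (q v\<^sub>0)" if "v \<in> J" for v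
  proof (rule ccontr)
    assume *: "sgn (q v) \<noteq> sgn (q v\<^sub>0)"
    have cont: "continuous_on J q"
      using q by (meson DERIV_isCont continuous_at_imp_continuous_on)
    have "q v \<le> 0 \<and> 0 \<le> q v\<^sub>0 \<or> q v\<^sub>0 \<le> 0 \<and> 0 \<le> q v"
      using * by (auto simp: sgn_if split: if_splits)
    then obtain z where "z \<in> J" "q z = 0"
      using \<open>v \<in> J\<close> assms(2)
      by (elim disjE conjE is_interval_IVT_zero[OF assms(1) cont, rotated 2]) blast+
    then show False
      using qnz by auto
  qed
  show ?thesis
  proof (rule that[of "sgn (q v\<^sub>0)" "1 / (K * m)"])
    show "sgn (q v\<^sub>0) \<in> {1, - 1}"
      using nz by (simp add: sgn_if)
    show "1 / (K * m) > 0"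
      using \<open>K > 0\<close> \<open>m > 0\<close> by simp
    show "1 / (K * m) * exp (4 * v) - 1 / m > 0" if "v \<in> J" for v
      unfolding recip[OF that] using qnz[OF that] by simp
    show "q v = sgn (q v\<^sub>0) / sqrt (1 / (K * m) * exp (4 * v) - 1 / m)" if "v \<in> J" for v
      unfolding recip[OF that] sgn[OF that, symmetric]
      by (simp add: real_sqrt_divide sgn_mult_abs)
  qed
qed

lemma bernoulli_has_derivative:
  fixes \<epsilon> a m :: real
  assumes "\<epsilon> \<in> {1, - 1}" "m > 0" "a * exp (4 * v) - 1 / m > 0"
  defines "q \<equiv> \<lambda>v. \<epsilon> / sqrt (a * exp (4 * v) - 1 / m)"
  shows "(q has_real_derivative - 2 * q v * (m + (q v)\<^sup>2) / m) (at v)"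
proof -
  define w where "w v = a * exp (4 * v) - 1 / m" for v
  define r where "r = sqrt (w v)"
  have w: "w v > 0" "(w has_real_derivative 4 * (w v + 1 / m)) (at v)"
    using assms(3) unfolding w_def by (auto intro!: derivative_eq_intros)
  then have r: "r > 0" "w v = r\<^sup>2"
    unfolding r_def by simp_all
  have q_w: "q = (\<lambda>v. \<epsilon> * inverse (sqrt (w v)))"
    unfolding q_def w_def by (simp add: divide_inverse)
  have q2: "(q v)\<^sup>2 = 1 / r\<^sup>2"
    unfolding q_def w_def[symmetric] r_def[symmetric]
    using assms(1) by (auto simp: power_divide)
  have "((\<lambda>v. sqrt (w v)) has_real_derivative inverse r / 2 * (4 * (w v + 1 / m))) (at v)"
    unfolding r_def by (rule DERIV_chain2[OF DERIV_real_sqrt[OF w(1)] w(2)])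
  then have "((\<lambda>v. inverse (sqrt (w v))) has_real_derivative
      - (inverse (sqrt (w v)) * (inverse r / 2 * (4 * (w v + 1 / m))) * inverse (sqrt (w v)))) (at v)"
    using w(1) by (intro DERIV_inverse') auto
  from DERIV_cmult[OF this, of \<epsilon>]
  have "(q has_real_derivative
      \<epsilon> * - (inverse r * (inverse r / 2 * (4 * (w v + 1 / m))) * inverse r)) (at v)"
    unfolding q_w r_def[symmetric] .
  moreover have "\<epsilon> * - (inverse r * (inverse r / 2 * (4 * (w v + 1 / m))) * inverse r)
      = - 2 * q v * (m + (q v)\<^sup>2) / m"
    unfolding q2 r(2) unfolding q_def w_def[symmetric] r_def[symmetric]
    using r(1) assms(2) by (simp add: divide_simps) (simp add: algebra_simps power2_eq_square)
  ultimately show ?thesis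
    by (simp only:)
qed

section \<open>The classification\<close>

lemma smooth_fun_on_DERIV:
  assumes "smooth_fun_on f I" "u \<in> I"
  shows "(f has_real_derivative deriv f u) (at u)"
    and "(deriv f has_real_derivative deriv (deriv f) u) (at u)"
proof -
  have "(deriv ^^ 0) f field_differentiable (at u)" "(deriv ^^ 1) f field_differentiable (at u)"
    using assms unfolding smooth_fun_on_def by blast+
  then show "(f has_real_derivative deriv f u) (at u)"
    and "(deriv f has_real_derivative deriv (deriv f) u) (at u)"
    by (simp_all add: DERIV_deriv_iff_field_differentiable)
qed

theorem theorem2p3:
  fixes I J :: "real set" and f g :: "real \<Rightarrow> real"
    and F N :: "real \<times> real \<Rightarrow> real^3"
  assumes "open I" and "is_interval I" and "I \<noteq> {}"
    and "open J" and "is_interval J" and "J \<noteq> {}"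
    and "smooth_fun_on f I" and "smooth_fun_on g J"
    and "F = translation_surface_II f g"
    and "unit_normal_field F (I \<times> J) N"
  shows "minimal_surface F (I \<times> J) N \<longleftrightarrow>
    (\<exists>a b c :: real. c \<noteq> 0 \<and>
       (\<forall>u\<in>I. cos (2 * c / sqrt (c\<^sup>2 + 1) * u - a) \<noteq> 0) \<and>
       (\<forall>u\<in>I. \<forall>v\<in>J. F (u, v) =
          vector [u,
            (c\<^sup>2 + 1) / (2 * c) * ln \<bar>cos (2 * c / sqrt (c\<^sup>2 + 1) * u - a)\<bar> + c * v + b,
            v])) \<or>
    (\<exists>\<epsilon>\<in>{1, - 1 :: real}. \<exists>v\<^sub>0\<in>J. \<exists>a b c :: real. a > 0 \<and>
       (\<forall>x\<in>J. a * exp (4 * x) - 1 / (c\<^sup>2 + 1) > 0) \<and>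
       (\<forall>u\<in>I. \<forall>v\<in>J. F (u, v) =
          vector [u,
            (LBINT x=ereal v\<^sub>0..ereal v. \<epsilon> / sqrt (a * exp (4 * x) - 1 / (c\<^sup>2 + 1))) + c * u + b,
            v])) \<or>
    (\<exists>b c :: real. \<forall>u\<in>I. \<forall>v\<in>J. F (u, v) = vector [u, c * u + b, v])"
  (is "_ \<longleftrightarrow> ?cos \<or> ?int \<or> ?cyl")
proof -
  obtain u\<^sub>0 v\<^sub>0 where u0: "u\<^sub>0 \<in> I" and v0: "v\<^sub>0 \<in> J"
    using assms(3,6) by auto
  have F: "F (u, v) = vector [u, h, v] \<longleftrightarrow> f u + g v = h" for u v h
    unfolding assms(9) translation_surface_II_def by (auto simp: vec_eq_iff forall_3)
  note iff = minimal_translation_surface_II_iff[OF assms(1,4) _ _ _ _ assms(10)[unfolded assms(9)],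
      folded assms(9)]
  note split_f = split_sum_has_derivative[OF assms(1) _ v0]
  note split_g = split_sum_has_derivative[OF assms(4) _ u0]
  have pos: "c\<^sup>2 + 1 > 0" for c :: real
    by (simp add: add_nonneg_pos)
  have "?cos \<or> ?int \<or> ?cyl" if min: "minimal_surface F (I \<times> J) N"
  proof -
    define p q where "p = deriv f" and "q = deriv g"
    note fD = smooth_fun_on_DERIV[OF assms(7), folded p_def]
    note gD = smooth_fun_on_DERIV[OF assms(8), folded q_def]
    have ode: "(1 + (q v)\<^sup>2) * deriv p u + (1 + (p u)\<^sup>2) * deriv q v
        + 2 * q v * (1 + (p u)\<^sup>2 + (q v)\<^sup>2) = 0" if "u \<in> I" "v \<in> J" for u v
      using iff[OF fD gD] min that by blast
    show ?thesis
    proof (cases "\<exists>x\<in>I. \<exists>y\<in>I. p x \<noteq> p y")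
      case True
      have "continuous_on I p"
        using fD(2) by (meson DERIV_isCont continuous_at_imp_continuous_on)
      with True obtain r s where "r \<in> I" "s \<in> I" "(p r)\<^sup>2 \<noteq> (p s)\<^sup>2"
        using obtain_distinct_squares[OF assms(2)] by metis
      note sep = separation[OF ode this]
      define c where "c = q v\<^sub>0"
      have qc: "q v = c" if "v \<in> J" for v
        unfolding c_def by (rule sep[OF _ _ that v0])
      have "deriv q v\<^sub>0 = 0"
        by (rule DERIV_zero_of_constant_on[OF assms(4) v0 gD(2)[OF v0] qc])
      then have ric: "(c\<^sup>2 + 1) * deriv p u = - 2 * c * (c\<^sup>2 + 1 + (p u)\<^sup>2)" if "u \<in> I" for u
        using ode[OF that v0] by (simp add: qc[OF v0] algebra_simps)
      \<comment> \<open>For \<open>c = 0\<close> the equation would make \<open>p\<close> constant.\<close>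
      have "c \<noteq> 0"
      proof
        assume "c = 0"
        then have "(p has_real_derivative 0) (at u)" if "u \<in> I" for u
          using ric[OF that] fD(2)[OF that] by simp
        then show False
          using is_interval_DERIV_zero_constant[OF assms(2)] True by metis
      qed
      obtain a where a: "\<And>u. u \<in> I \<Longrightarrow> cos (2 * c / sqrt (c\<^sup>2 + 1) * u - a) \<noteq> 0"
        "\<And>u. u \<in> I \<Longrightarrow> p u = - sqrt (c\<^sup>2 + 1) * tan (2 * c / sqrt (c\<^sup>2 + 1) * u - a)"
        using riccati_solution[OF assms(2) fD(2) ric] by blast
      have "((\<lambda>u. (c\<^sup>2 + 1) / (2 * c) * ln \<bar>cos (2 * c / sqrt (c\<^sup>2 + 1) * u - a)\<bar>)
          has_real_derivative p u) (at u)" if "u \<in> I" for u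
        unfolding a(2)[OF that] by (rule log_cos_has_derivative[OF \<open>c \<noteq> 0\<close> a(1)[OF that]])
      then obtain b1 where b1: "\<And>u. u \<in> I \<Longrightarrow>
          f u = (c\<^sup>2 + 1) / (2 * c) * ln \<bar>cos (2 * c / sqrt (c\<^sup>2 + 1) * u - a)\<bar> + b1"
        using is_interval_DERIV_eq_obtain_const[OF assms(2) fD(1)] by blast
      have "((\<lambda>v. c * v) has_real_derivative q v) (at v)" if "v \<in> J" for v
        unfolding qc[OF that] by (auto intro!: derivative_eq_intros)
      then obtain b2 where b2: "\<And>v. v \<in> J \<Longrightarrow> g v = c * v + b2"
        using is_interval_DERIV_eq_obtain_const[OF assms(5) gD(1)] by blast
      have ?cos
        unfolding F
        by (rule exI[of _ a], rule exI[of _ "b1 + b2"], rule exI[of _ c])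
          (use \<open>c \<noteq> 0\<close> a(1) in \<open>auto simp: b1 b2\<close>)
      then show ?thesis ..
    next
      case False
      define c where "c = p u\<^sub>0"
      have pc: "p u = c" if "u \<in> I" for u
        unfolding c_def using False that u0 by blast
      have "deriv p u\<^sub>0 = 0"
        by (rule DERIV_zero_of_constant_on[OF assms(1) u0 fD(2)[OF u0] pc])
      then have ber: "(c\<^sup>2 + 1) * deriv q v + 2 * q v * (c\<^sup>2 + 1 + (q v)\<^sup>2) = 0" if "v \<in> J" for v
        using ode[OF u0 that] by (simp add: pc[OF u0] algebra_simps)
      have "((\<lambda>u. c * u) has_real_derivative p u) (at u)" if "u \<in> I" for u
        unfolding pc[OF that] by (auto intro!: derivative_eq_intros)
      then obtain b1 where b1: "\<And>u. u \<in> I \<Longrightarrow> f u = c * u + b1"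
        using is_interval_DERIV_eq_obtain_const[OF assms(2) fD(1)] by blast
      show ?thesis
      proof (cases "\<forall>v\<in>J. q v = 0")
        case True
        then obtain b2 where "\<And>v. v \<in> J \<Longrightarrow> g v = b2"
          using is_interval_DERIV_zero_constant[OF assms(5), of g] gD(1) by metis
        then have ?cyl
          unfolding F by (intro exI[of _ c] exI[of _ "b1 + b2"]) (auto simp: b1)
        then show ?thesis
          by blast
      next
        case False
        \<comment> \<open>Taken as the lower limit of the integral; the choice only affects \<open>b2\<close>.\<close>
        then obtain v\<^sub>1 where v1: "v\<^sub>1 \<in> J" "q v\<^sub>1 \<noteq> 0"
          by blast
        obtain \<epsilon> a :: real where ea: "\<epsilon> \<in> {1, - 1}" "a > 0"
          and w: "\<And>v. v \<in> J \<Longrightarrow> a * exp (4 * v) - 1 / (c\<^sup>2 + 1) > 0"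
          and qv: "\<And>v. v \<in> J \<Longrightarrow> q v = \<epsilon> / sqrt (a * exp (4 * v) - 1 / (c\<^sup>2 + 1))"
          using bernoulli_solution[OF assms(5) v1(1) pos gD(2) ber v1(2)] by metis
        have "continuous_on J (\<lambda>v. \<epsilon> / sqrt (a * exp (4 * v) - 1 / (c\<^sup>2 + 1)))"
          using w by (force intro!: continuous_intros)
        note int = interval_integral_has_derivative[OF assms(4,5) v1(1) _ this]
        have "((\<lambda>v. LBINT x=ereal v\<^sub>1..ereal v. \<epsilon> / sqrt (a * exp (4 * x) - 1 / (c\<^sup>2 + 1)))
            has_real_derivative q v) (at v)" if "v \<in> J" for v
          unfolding qv[OF that] by (rule int[OF that])
        then obtain b2 where b2: "\<And>v. v \<in> J \<Longrightarrow> g v =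
            (LBINT x=ereal v\<^sub>1..ereal v. \<epsilon> / sqrt (a * exp (4 * x) - 1 / (c\<^sup>2 + 1))) + b2"
          using is_interval_DERIV_eq_obtain_const[OF assms(5) gD(1)] by blast
        have ?int
          unfolding F
          by (rule bexI[OF _ ea(1)], rule bexI[OF _ v1(1)], rule exI[of _ a],
              rule exI[of _ "b1 + b2"], rule exI[of _ c])
            (use ea(2) w in \<open>auto simp: b1 b2\<close>)
        then show ?thesis
          by blast
      qed
    qed
  qed
  moreover have "minimal_surface F (I \<times> J) N" if ?cos
  proof -
    from that obtain a b c where "c \<noteq> 0"
      and cos: "\<And>u. u \<in> I \<Longrightarrow> cos (2 * c / sqrt (c\<^sup>2 + 1) * u - a) \<noteq> 0"
      and sum: "\<And>u v. u \<in> I \<Longrightarrow> v \<in> J \<Longrightarrow> f u + g v =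
        (c\<^sup>2 + 1) / (2 * c) * ln \<bar>cos (2 * c / sqrt (c\<^sup>2 + 1) * u - a)\<bar> + c * v + b"
      unfolding F by blast
    define s where "s = sqrt (c\<^sup>2 + 1)"
    have s: "s > 0" "c\<^sup>2 = s\<^sup>2 - 1"
      unfolding s_def using pos[of c] by simp_all
    have fD: "(f has_real_derivative - s * tan (2 * c / s * u - a)) (at u)" if "u \<in> I" for u
      unfolding s_def
      by (rule split_f[OF that _ log_cos_has_derivative[OF \<open>c \<noteq> 0\<close> cos[OF that]],
            where g = g and k = "c * v\<^sub>0 + b"])
        (use sum[OF _ v0] in \<open>simp add: algebra_simps\<close>)
    have gD: "(g has_real_derivative c) (at v)" if "v \<in> J" for v
      by (rule split_g[OF that, where \<phi> = "\<lambda>v. c * v" and g = f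
            and k = "(c\<^sup>2 + 1) / (2 * c) * ln \<bar>cos (2 * c / sqrt (c\<^sup>2 + 1) * u\<^sub>0 - a)\<bar> + b"])
        (use sum[OF u0] in \<open>auto simp: add.commute intro!: derivative_eq_intros\<close>)
    have "(1 + c\<^sup>2) * (- s * (2 * c / s) * (1 + T\<^sup>2)) + (1 + (- s * T)\<^sup>2) * 0
        + 2 * c * (1 + (- s * T)\<^sup>2 + c\<^sup>2) = 0" for T
      using s(1) by (simp add: s(2) algebra_simps power_mult_distrib)
    then show ?thesis
      by (intro iffD2[OF iff[OF fD tan_has_derivative_affine[OF cos[folded s_def]] gD DERIV_const]]
          ballI)
  qed
  moreover have "minimal_surface F (I \<times> J) N" if ?int
  proof -
    from that obtain \<epsilon> v\<^sub>1 a b c :: real where e: "\<epsilon> \<in> {1, - 1}" and "v\<^sub>1 \<in> J"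
      and w: "\<And>x. x \<in> J \<Longrightarrow> a * exp (4 * x) - 1 / (c\<^sup>2 + 1) > 0"
      and sum: "\<And>u v. u \<in> I \<Longrightarrow> v \<in> J \<Longrightarrow> f u + g v =
        (LBINT x=ereal v\<^sub>1..ereal v. \<epsilon> / sqrt (a * exp (4 * x) - 1 / (c\<^sup>2 + 1))) + c * u + b"
      unfolding F by blast
    define q where "q = (\<lambda>x. \<epsilon> / sqrt (a * exp (4 * x) - 1 / (c\<^sup>2 + 1)))"
    have "continuous_on J q"
      unfolding q_def using w by (force intro!: continuous_intros)
    note int = interval_integral_has_derivative[OF assms(4,5) \<open>v\<^sub>1 \<in> J\<close> _ this]
    have fD: "(f has_real_derivative c) (at u)" if "u \<in> I" for u
      by (rule split_f[OF that, where \<phi> = "\<lambda>u. c * u" and g = g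
            and k = "(LBINT x=ereal v\<^sub>1..ereal v\<^sub>0. q x) + b"])
        (use sum[OF _ v0] in \<open>auto simp: q_def intro!: derivative_eq_intros\<close>)
    have gD: "(g has_real_derivative q v) (at v)" if "v \<in> J" for v
      by (rule split_g[OF that _ int[OF that], where g = f and k = "c * u\<^sub>0 + b"])
        (use sum[OF u0] in \<open>simp add: q_def algebra_simps\<close>)
    have qD: "(q has_real_derivative - 2 * q v * (c\<^sup>2 + 1 + (q v)\<^sup>2) / (c\<^sup>2 + 1)) (at v)"
      if "v \<in> J" for v
      unfolding q_def by (rule bernoulli_has_derivative[OF e pos w[OF that]])
    show ?thesis
    proof (intro iffD2[OF iff[OF fD DERIV_const gD qD]] ballI)
      fix v
      show "(1 + (q v)\<^sup>2) * 0 + (1 + c\<^sup>2) * (- 2 * q v * (c\<^sup>2 + 1 + (q v)\<^sup>2) / (c\<^sup>2 + 1))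
          + 2 * q v * (1 + c\<^sup>2 + (q v)\<^sup>2) = 0"
        using pos[of c] by (simp add: add.commute)
    qed
  qed
  moreover have "minimal_surface F (I \<times> J) N" if ?cyl
  proof -
    from that obtain b c where sum: "\<And>u v. u \<in> I \<Longrightarrow> v \<in> J \<Longrightarrow> f u + g v = c * u + b"
      unfolding F by blast
    have fD: "(f has_real_derivative c) (at u)" if "u \<in> I" for u
      by (rule split_f[OF that, where \<phi> = "\<lambda>u. c * u" and g = g and k = b])
        (use sum[OF _ v0] in \<open>auto intro!: derivative_eq_intros\<close>)
    have gD: "(g has_real_derivative 0) (at v)" if "v \<in> J" for v
      by (rule split_g[OF that, where \<phi> = "\<lambda>_. 0" and g = f and k = "c * u\<^sub>0 + b"])
        (use sum[OF u0] in \<open>auto simp: add.commute\<close>)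
    show ?thesis
      by (rule iffD2[OF iff[OF fD DERIV_const gD DERIV_const]]) simp_all
  qed
  ultimately show ?thesis
    by argo
qed

end
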